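(* Let $3\le p<q$ be prime numbers and let $n\ge 3$. For integers $\alpha_1,\dots,\alpha_{n-2}$ and $\beta_1,\dots,\beta_{n-2}$ let $T(\alpha,\beta)$ be the $n\times n$ matrix $$T(\alpha,\beta)=\begin{bmatrix} -\left(\frac{q+\alpha_{n-2}}{2}\right) & \frac{p-\beta_{n-2}}{2} & 0 & 0 & \cdots & 0 & 1\\ \frac{q-\alpha_1}{2} & -\left(\frac{p+\beta_1}{2}\right) & 1 & 0 & \cdots & 0 & 0\\ \alpha_1 & \beta_1 & -2 & 0 & \cdots & 0 & 0\\ \alpha_2 & \beta_2 & 0 & -2 & \cdots & 0 & 0\\ \vdots & \vdots & \vdots & \vdots & \ddots & \vdots & \vdots\\ \alpha_{n-2} & \beta_{n-2} & 0 & 0 & \cdots & 0 & -2 \end{bmatrix},$$ that is: row 1 has entries $-\frac{q+\alpha_{n-2}}{2}$, $\frac{p-\beta_{n-2}}{2}$ in columns 1, 2, entry $1$ in column $n$, and zeros elsewhere; row 2 has entries $\frac{q-\alpha_1}{2}$, $-\frac{p+\beta_1}{2}$, $1$ in columns 1, 2, 3 and zeros elsewhere; and for $1\le i\le n-2$ row $i+2$ has entries $\alpha_i$, $\beta_i$ in columns 1, 2, entry $-2$ in column $i+2$, and zeros elsewhere. (a) Let $A=\langle p,q,h_1,\dots,h_{n-2}\rangle\in KW(p,q)$ be a numerical semigroup of embedding dimension $n$, with minimal generators $p,q,h_1,\dots,h_{n-2}$, where $h_i=pq-x_ip-y_iq$ with integers $0<x_1<\dots<x_{n-2}$, $y_1>\dots>y_{n-2}>0$,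 $2x_i\le q$, $2y_i\le p$. Then there are odd positive integers $\alpha_i,\beta_i$ ($1\le i\le n-2$) with $q>\alpha_1>\dots>\alpha_{n-2}>0$ and $0<\beta_1<\dots<\beta_{n-2}<p$ such that $T(\alpha,\beta)$ is a principal matrix of $A$ (with respect to the ordered generators $p,q,h_1,\dots,h_{n-2}$). (b) Conversely, for any odd positive integers $\alpha_i,\beta_i$ ($1\le i\le n-2$) with $q>\alpha_1>\dots>\alpha_{n-2}>0$ and $0<\beta_1<\dots<\beta_{n-2}<p$, the matrix $T(\alpha,\beta)$ is a principal matrix of some numerical semigroup in $KW(p,q)$.
   Context: $\mathbb N$ denotes the nonnegative integers, and $\langle a_1,\dots,a_n\rangle$ the submonoid of $\mathbb N$ generated by $a_1,\dots,a_n$. A numerical semigroup is such a submonoid with $\gcd(a_1,\dots,a_n)=1$; its embedding dimension is the size of its minimal generating set. Principal matrix: let $\mathbf a=(a_1,\dots,a_n)$ be positive integers minimally generating a semigroup $\langle\mathbf a\rangle$. A principal matrix of $\langle \mathbf a\rangle$ is an $n\times n$ integer matrix $M$ with diagonal entries $-c_1,\dots,-c_n$ and nonnegative off-diagonal entries such that $M\mathbf a=0$ (with $\mathbf a$ regarded as a column vector) and, for each $i$, $c_i$ is the smallest positive integer such that $c_ia_i\in\langle a_j : j\neq i\rangle$. The diagonal is uniquely determined by $\mathbf a$, but the off-diagonal entries need not be. The class $KW(p,q)$: for coprime integers $3\le p<q$, $KW(p,q)$ is the set of all numerical semigroups $H$ with $\langle p,q\rangle\subseteq H\subseteq\langle p,q,r\rangle$,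 where $r=p/2$ if $p$ is even, $r=q/2$ if $q$ is even, and $r=(p+q)/2$ if $p$ and $q$ are both odd. *)

theory Defs
  imports "Jordan_Normal_Form.Matrix" "HOL-Computational_Algebra.Primes" "HOL.Hull"
begin

definition submonoid_nat :: "nat set \<Rightarrow> bool" where
  "submonoid_nat M \<longleftrightarrow> 0 \<in> M \<and> (\<forall>x\<in>M. \<forall>y\<in>M. x + y \<in> M)"

definition monoid_gen :: "nat set \<Rightarrow> nat set" where
  "monoid_gen S = submonoid_nat hull S"

definition numerical_semigroup :: "nat set \<Rightarrow> bool" where
  "numerical_semigroup H \<longleftrightarrow> (\<exists>S. finite S \<and> Gcd S = 1 \<and> H = monoid_gen S)"

definition minimal_generating_set :: "nat set \<Rightarrow> nat set \<Rightarrow> bool" where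
  "minimal_generating_set X H \<longleftrightarrow> monoid_gen X = H \<and> (\<forall>Y. Y \<subset> X \<longrightarrow> monoid_gen Y \<noteq> H)"

(* Every submonoid H of the naturals has exactly one minimal generating set, namely the nonzero
   elements of H that are not sums of two nonzero elements of H, so THE is well defined. *)
definition embedding_dimension :: "nat set \<Rightarrow> nat" where
  "embedding_dimension H = card (THE X. minimal_generating_set X H)"

definition minimally_generating :: "nat list \<Rightarrow> bool" where
  "minimally_generating a \<longleftrightarrow> distinct a \<and> minimal_generating_set (set a) (monoid_gen (set a))"

(* Meant for coprime p, q with 3 \<le> p < q; every division by 2 is then exact. *)
definition KW :: "nat \<Rightarrow> nat \<Rightarrow> nat set set" where
  "KW p q =
     (let r = (if even p then p div 2 else if even q then q div 2 else (p + q) div 2)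
      in {H. numerical_semigroup H \<and> monoid_gen {p, q} \<subseteq> H \<and> H \<subseteq> monoid_gen {p, q, r}})"

(* c is the smallest positive integer such that c times the i-th entry of a lies in the monoid
   generated by the other entries. Stated as a relation, since no such c exists if a has length 1. *)
definition principal_coeff :: "nat list \<Rightarrow> nat \<Rightarrow> nat \<Rightarrow> bool" where
  "principal_coeff a i c \<longleftrightarrow>
     (let G = monoid_gen {a ! j | j. j < length a \<and> j \<noteq> i}
      in 0 < c \<and> c * a ! i \<in> G \<and> (\<forall>d. 0 < d \<and> d * a ! i \<in> G \<longrightarrow> c \<le> d))"

(* M is a principal matrix of the semigroup generated by a, with respect to the order of the
   generators in a. *)
definition principal_matrix :: "nat list \<Rightarrow> int mat \<Rightarrow> bool" where
  "principal_matrix a M \<longleftrightarrow>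
     (\<forall>x\<in>set a. 0 < x) \<and> minimally_generating a \<and>
     M \<in> carrier_mat (length a) (length a) \<and>
     (\<forall>i<length a. \<exists>c. principal_coeff a i c \<and> M $$ (i, i) = - int c) \<and>
     (\<forall>i<length a. \<forall>j<length a. i \<noteq> j \<longrightarrow> 0 \<le> M $$ (i, j)) \<and>
     M *\<^sub>v vec_of_list (map int a) = 0\<^sub>v (length a)"

(* Rows and columns are counted from 0, while the parameters \<alpha>, \<beta> are indexed by 1, ..., n - 2;
   so row i \<ge> 2 carries the parameters with index i - 1. The divisions by 2 are exact when p, q
   and all parameters are odd. *)
definition T_mat :: "nat \<Rightarrow> nat \<Rightarrow> nat \<Rightarrow> (nat \<Rightarrow> int) \<Rightarrow> (nat \<Rightarrow> int) \<Rightarrow> int mat" where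
  "T_mat p q n \<alpha> \<beta> = mat n n (\<lambda>(i, j).
     if i = 0 then
       (if j = 0 then - ((int q + \<alpha> (n - 2)) div 2)
        else if j = 1 then (int p - \<beta> (n - 2)) div 2
        else if j = n - 1 then 1 else 0)
     else if i = 1 then
       (if j = 0 then (int q - \<alpha> 1) div 2
        else if j = 1 then - ((int p + \<beta> 1) div 2)
        else if j = 2 then 1 else 0)
     else
       (if j = 0 then \<alpha> (i - 1)
        else if j = 1 then \<beta> (i - 1)
        else if j = i then - 2 else 0))"

definition admissible :: "nat \<Rightarrow> nat \<Rightarrow> nat \<Rightarrow> (nat \<Rightarrow> int) \<Rightarrow> (nat \<Rightarrow> int) \<Rightarrow> bool" where
  "admissible p q n \<alpha> \<beta> \<longleftrightarrow>
     (\<forall>i\<in>{1..n - 2}. odd (\<alpha> i) \<and> 0 < \<alpha> i \<and> odd (\<beta> i) \<and> 0 < \<beta> i) \<and>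
     int q > \<alpha> 1 \<and> strict_antimono_on {1..n - 2} \<alpha> \<and> \<alpha> (n - 2) > 0 \<and>
     0 < \<beta> 1 \<and> strict_mono_on {1..n - 2} \<beta> \<and> \<beta> (n - 2) < int p"

end

theory Submission
  imports Defs
begin

text \<open>
  Put \<open>\<alpha>\<^sub>i = q - 2 * x\<^sub>i\<close> and \<open>\<beta>\<^sub>i = p - 2 * y\<^sub>i\<close>. Then \<open>h\<^sub>i = p * q - x\<^sub>i * p - y\<^sub>i * q\<close> becomes
  \<open>2 * h\<^sub>i = \<alpha>\<^sub>i * p + \<beta>\<^sub>i * q\<close>, and the order and size conditions on \<open>x\<close> and \<open>y\<close> become those on
  \<open>\<alpha>\<close> and \<open>\<beta>\<close>. So both directions follow from one claim (\<open>principal_matrix_T_mat\<close>): if the generators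
  \<open>p, q, h\<^sub>1, \<dots>\<close> satisfy these equations for admissible parameters, then \<open>T\<close> is a principal matrix of
  them. Conversely, admissible parameters define generators by the same equations, and these lie in
  \<open>\<langle>p, q, (p + q) / 2\<rangle>\<close> because the parameters are odd and positive (\<open>monoid_gen_in_KW\<close>).

  To prove the claim, give a generator \<open>g\<close> with \<open>2 * g = u * p + v * q\<close> the coordinates \<open>(u, v)\<close>:
  these are \<open>(2, 0)\<close> for \<open>p\<close>, \<open>(0, 2)\<close> for \<open>q\<close> and \<open>(\<alpha>\<^sub>i, \<beta>\<^sub>i)\<close> for \<open>h\<^sub>i\<close>. As \<open>p\<close> and \<open>q\<close> are coprime,
  coordinates are unique up to multiples of \<open>(q, -p)\<close>, so a relation \<open>c * g\<^sub>i = (\<Sum>j\<noteq>i. m\<^sub>j * g\<^sub>j)\<close> is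
  an equation between coordinate pairs up to \<open>t * (q, -p)\<close> for an integer \<open>t\<close>
  (\<open>relation_coordinates\<close>). A parity argument then settles each generator.

  \<^item> For \<open>p\<close>, the second coordinate forces \<open>t > 0\<close>. If \<open>t \<ge> 2\<close> then \<open>c \<ge> q\<close>; if \<open>t = 1\<close> then
    oddness of \<open>q\<close> forces some \<open>h\<^sub>j\<close> to occur, and the cheapest choice gives
    \<open>2 * c \<ge> q + \<alpha>\<^bsub>n-2\<^esub>\<close> (\<open>principal_coeff_lower_bound\<close>). The case of \<open>q\<close> is symmetric, with least
    value \<open>\<beta>\<^sub>1\<close>.
  \<^item> If \<open>h\<^sub>i\<close> were generated by the others, its small coordinates would force \<open>t = 0\<close>, and oddness of
    \<open>\<alpha>\<^sub>i\<close> would force some \<open>h\<^sub>j\<close> to occur with \<open>\<alpha>\<^sub>j \<le> \<alpha>\<^sub>i\<close> and \<open>\<beta>\<^sub>j \<le> \<beta>\<^sub>i\<close>. This is impossible, since one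
    sequence decreases and the other increases (\<open>no_half_point_relation\<close>). So the coefficient of
    \<open>h\<^sub>i\<close> is at least \<open>2\<close>.

  All these coefficients are at least \<open>2\<close>, which is minimality of the generators; and the rows of
  \<open>T\<close> are relations that attain them.
\<close>

section \<open>Finitely generated submonoids of the naturals\<close>

lemma submonoid_nat_monoid_gen: "submonoid_nat (monoid_gen S)"
  unfolding monoid_gen_def by (rule hull_in) (auto simp: submonoid_nat_def)

lemma subset_monoid_gen: "S \<subseteq> monoid_gen S"
  unfolding monoid_gen_def by (rule hull_subset)

lemma monoid_gen_least: "S \<subseteq> M \<Longrightarrow> submonoid_nat M \<Longrightarrow> monoid_gen S \<subseteq> M"
  unfolding monoid_gen_def by (rule hull_minimal)

lemma monoid_gen_subset_iff: "monoid_gen S \<subseteq> monoid_gen T \<longleftrightarrow> S \<subseteq> monoid_gen T"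
  using monoid_gen_least[OF _ submonoid_nat_monoid_gen] subset_monoid_gen by blast

lemma submonoid_nat_add: "submonoid_nat M \<Longrightarrow> x \<in> M \<Longrightarrow> y \<in> M \<Longrightarrow> x + y \<in> M"
  by (simp add: submonoid_nat_def)

lemma submonoid_nat_mult: "submonoid_nat M \<Longrightarrow> x \<in> M \<Longrightarrow> k * x \<in> M"
  by (induction k) (auto simp: submonoid_nat_def)

lemma submonoid_nat_sum:
  assumes "submonoid_nat M" "finite J" "\<And>j. j \<in> J \<Longrightarrow> f j \<in> M"
  shows "sum f J \<in> M"
  using assms(2,3)
  by (induction J rule: finite_induct) (use assms(1) in \<open>auto simp: submonoid_nat_def\<close>)

lemma monoid_gen_image_eq:
  assumes "finite J"
  shows "monoid_gen (g ` J) = {(\<Sum>j\<in>J. m j * g j) | m. True}" (is "_ = ?C")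
proof
  have "g k \<in> ?C" if "k \<in> J" for k
  proof -
    have "(\<Sum>j\<in>J. (if j = k then 1 else 0) * g j) = (\<Sum>j\<in>J. if j = k then g j else 0)"
      by (rule sum.cong) auto
    also have "\<dots> = g k" using assms that by simp
    finally show ?thesis by (auto intro!: exI[of _ "\<lambda>j. if j = k then 1 else 0"])
  qed
  moreover have "submonoid_nat ?C"
    unfolding submonoid_nat_def
  proof (intro conjI ballI)
    show "0 \<in> ?C" by (auto intro!: exI[of _ "\<lambda>_. 0"])
    fix x y assume "x \<in> ?C" "y \<in> ?C"
    then obtain m l where "x = (\<Sum>j\<in>J. m j * g j)" "y = (\<Sum>j\<in>J. l j * g j)" by blast
    then have "x + y = (\<Sum>j\<in>J. (m j + l j) * g j)"
      by (simp add: sum.distrib add_mult_distrib)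
    then show "x + y \<in> ?C" by (intro CollectI exI[of _ "\<lambda>j. m j + l j"]) simp
  qed
  ultimately show "monoid_gen (g ` J) \<subseteq> ?C" by (intro monoid_gen_least) auto
next
  show "?C \<subseteq> monoid_gen (g ` J)"
    using subset_monoid_gen[of "g ` J"]
    by (auto intro!: submonoid_nat_sum submonoid_nat_mult submonoid_nat_monoid_gen assms)
qed

text \<open>Distinctness comes for free: a repeated entry already lies in the monoid generated by the
  entries at the other positions.\<close>

lemma minimally_generatingI:
  assumes "\<And>i. i < length a \<Longrightarrow> a ! i \<notin> monoid_gen {a ! j | j. j < length a \<and> j \<noteq> i}"
  shows "minimally_generating a"
  unfolding minimally_generating_def minimal_generating_set_def
proof (intro conjI allI impI refl)
  show "distinct a"
    unfolding distinct_conv_nth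
  proof (intro allI impI notI)
    fix i j assume *: "i < length a" "j < length a" "i \<noteq> j" "a ! i = a ! j"
    then have "a ! i \<in> {a ! j | j. j < length a \<and> j \<noteq> i}" by auto
    then have "a ! i \<in> monoid_gen {a ! j | j. j < length a \<and> j \<noteq> i}"
      by (rule subsetD[OF subset_monoid_gen])
    then show False using assms[OF \<open>i < length a\<close>] by contradiction
  qed
  fix Y assume Y: "Y \<subset> set a"
  then obtain x where "x \<in> set a" "x \<notin> Y" by blast
  then obtain i where i: "i < length a" "a ! i \<notin> Y" by (metis in_set_conv_nth)
  have "Y \<subseteq> {a ! j | j. j < length a \<and> j \<noteq> i}"
  proof
    fix y assume "y \<in> Y"
    with Y obtain j where "j < length a" "y = a ! j" by (metis in_set_conv_nth psubsetD)
    with \<open>y \<in> Y\<close> i(2) show "y \<in> {a ! j | j. j < length a \<and> j \<noteq> i}" by auto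
  qed
  then have "Y \<subseteq> monoid_gen {a ! j | j. j < length a \<and> j \<noteq> i}"
    using subset_monoid_gen by (rule subset_trans)
  then have "monoid_gen Y \<subseteq> monoid_gen {a ! j | j. j < length a \<and> j \<noteq> i}"
    by (simp only: monoid_gen_subset_iff)
  then have "a ! i \<notin> monoid_gen Y" using assms[OF i(1)] by (rule contra_subsetD)
  moreover have "a ! i \<in> monoid_gen (set a)"
    using i(1) by (intro subsetD[OF subset_monoid_gen] nth_mem)
  ultimately show "monoid_gen Y \<noteq> monoid_gen (set a)" by metis
qed

section \<open>Relations between generators in half-integer coordinates\<close>

lemma coprime_linear_relation:
  fixes p q A B :: int
  assumes "coprime p q" "q \<noteq> 0" "A * p = B * q"
  obtains t where "A = q * t" "B = p * t"
proof -
  have "q dvd A * p" using assms(3) by simp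
  then have "q dvd A" using assms(1) by (simp add: coprime_commute coprime_dvd_mult_left_iff)
  then obtain t where t: "A = q * t" by (elim dvdE)
  then have "B = p * t" using assms(2,3) by (simp add: mult_ac)
  then show ?thesis using t that by blast
qed

text \<open>The pair \<open>(u j, v j)\<close> gives coordinates of \<open>2 * g j\<close>, doubled so that the elements
  \<open>(\<alpha> * p + \<beta> * q) / 2\<close> have integer ones. Both sides of a relation represent the same integer, so
  their coordinates differ by a multiple of the syzygy \<open>(q, -p)\<close>.\<close>

lemma relation_coordinates:
  fixes p q :: int and g m :: "nat \<Rightarrow> nat" and u v :: "nat \<Rightarrow> int"
  assumes "coprime p q" "q \<noteq> 0"
    and coord: "\<And>j. j \<in> insert i J \<Longrightarrow> 2 * int (g j) = u j * p + v j * q"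
    and rel: "c * g i = (\<Sum>j\<in>J. m j * g j)"
  obtains t where "int c * u i = (\<Sum>j\<in>J. int (m j) * u j) + q * t"
    and "(\<Sum>j\<in>J. int (m j) * v j) = int c * v i + p * t"
proof -
  have "int c * (u i * p + v i * q) = 2 * int (c * g i)"
    using coord[of i] by simp
  also have "\<dots> = (\<Sum>j\<in>J. int (m j) * (2 * int (g j)))"
    by (simp add: rel sum_distrib_left mult_ac)
  also have "\<dots> = (\<Sum>j\<in>J. int (m j) * (u j * p + v j * q))"
    using coord by (intro sum.cong) auto
  also have "\<dots> = (\<Sum>j\<in>J. int (m j) * u j) * p + (\<Sum>j\<in>J. int (m j) * v j) * q"
    by (simp add: sum_distrib_left algebra_simps sum.distrib)
  finally have "(int c * u i - (\<Sum>j\<in>J. int (m j) * u j)) * p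
      = ((\<Sum>j\<in>J. int (m j) * v j) - int c * v i) * q"
    by (simp add: algebra_simps)
  from coprime_linear_relation[OF assms(1,2) this] obtain t where
    "int c * u i - (\<Sum>j\<in>J. int (m j) * u j) = q * t"
    "(\<Sum>j\<in>J. int (m j) * v j) - int c * v i = p * t" .
  then show ?thesis by (intro that[of t]) (simp_all add: algebra_simps)
qed

lemma odd_sum_has_odd_term:
  fixes u :: "nat \<Rightarrow> int"
  assumes "odd (\<Sum>j\<in>J. int (m j) * u j)"
  obtains j where "j \<in> J" "0 < m j" "odd (u j)"
proof -
  have "\<exists>j\<in>J. odd (int (m j) * u j)" using assms by (meson dvd_sum)
  then obtain j where "j \<in> J" "odd (int (m j) * u j)" by blast
  then show ?thesis using that[of j] by (cases "m j = 0") auto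
qed

lemma coeff_le_sum:
  fixes u :: "nat \<Rightarrow> int"
  assumes "finite J" "\<And>j. j \<in> J \<Longrightarrow> 0 \<le> u j" "k \<in> J" "0 < m k"
  shows "u k \<le> (\<Sum>j\<in>J. int (m j) * u j)"
proof -
  have "1 * u k \<le> int (m k) * u k" using assms by (intro mult_right_mono) auto
  also have "\<dots> \<le> (\<Sum>j\<in>J. int (m j) * u j)"
    using assms by (intro member_le_sum) auto
  finally show ?thesis by simp
qed

text \<open>The two equations are the coordinates of a relation \<open>c * p = (\<Sum>j\<in>J. m j * g j)\<close>. The second
  one gives \<open>t > 0\<close>, as positive \<open>v j\<close> and \<open>t = 0\<close> would make all \<open>m j\<close> vanish. In the first one
  \<open>t \<ge> 2\<close> is too expensive already, and for \<open>t = 1\<close> parity requires an odd \<open>u j\<close>, which costs at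
  least \<open>A\<close>.\<close>

lemma principal_coeff_lower_bound:
  fixes p q A t :: int and u v :: "nat \<Rightarrow> int"
  assumes "finite J" "0 < p" "0 < q" "odd q" "A \<le> q" "0 < c"
    and u: "\<And>j. j \<in> J \<Longrightarrow> 0 \<le> u j" "\<And>j. j \<in> J \<Longrightarrow> odd (u j) \<Longrightarrow> A \<le> u j"
    and v: "\<And>j. j \<in> J \<Longrightarrow> 0 < v j"
    and c: "2 * int c = (\<Sum>j\<in>J. int (m j) * u j) + q * t"
    and 0: "(\<Sum>j\<in>J. int (m j) * v j) = p * t"
  shows "q + A \<le> 2 * int c"
proof -
  have vnn: "0 \<le> v j" if "j \<in> J" for j using v[OF that] by simp
  have unn: "0 \<le> (\<Sum>j\<in>J. int (m j) * u j)" using u(1) by (intro sum_nonneg) auto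
  have "0 \<le> p * t" using vnn by (subst 0[symmetric], intro sum_nonneg) auto
  then have "0 \<le> t" using \<open>0 < p\<close> by (simp add: zero_le_mult_iff)
  moreover have "t \<noteq> 0"
  proof
    assume "t = 0"
    have "m j = 0" if "j \<in> J" for j
      using coeff_le_sum[of J v j m] assms(1) vnn v that 0 \<open>t = 0\<close> by force
    then show False using c \<open>t = 0\<close> \<open>0 < c\<close> by simp
  qed
  ultimately consider "t = 1" | "2 \<le> t" by linarith
  then show ?thesis
  proof cases
    case 1
    \<comment> \<open>As \<open>q\<close> is odd, the remaining sum is odd, so some \<open>u j\<close> with \<open>A \<le> u j\<close> occurs in it.\<close>
    then have "odd (\<Sum>j\<in>J. int (m j) * u j)"
      using c \<open>odd q\<close> by (metis even_add dvd_triv_left mult.right_neutral)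
    then obtain j where "j \<in> J" "0 < m j" "odd (u j)" by (rule odd_sum_has_odd_term)
    then have "A \<le> (\<Sum>j\<in>J. int (m j) * u j)"
      using coeff_le_sum[of J u j m] assms(1) u by force
    then show ?thesis using c 1 by simp
  next
    case 2
    then have "q * 2 \<le> q * t" using \<open>0 < q\<close> by (intro mult_left_mono) auto
    then show ?thesis using c unn \<open>A \<le> q\<close> by linarith
  qed
qed

text \<open>The two equations are the coordinates of a relation that writes the element with coordinates
  \<open>(a, b)\<close> in terms of others. As \<open>a < q\<close> and \<open>b < p\<close>, there is no room for a nonzero \<open>t\<close>, so every
  element that occurs has coordinates at most \<open>(a, b)\<close>. Since \<open>a\<close> is odd, one of them has an odd
  first coordinate.\<close>

lemma no_half_point_relation:
  fixes p q a b t :: int and u v :: "nat \<Rightarrow> int"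
  assumes "finite J" "0 < p" "0 < q" "odd a" "a < q" "b < p"
    and nonneg: "\<And>j. j \<in> J \<Longrightarrow> 0 \<le> u j" "\<And>j. j \<in> J \<Longrightarrow> 0 \<le> v j"
    and incomp: "\<And>j. j \<in> J \<Longrightarrow> odd (u j) \<Longrightarrow> a < u j \<or> b < v j"
    and a: "a = (\<Sum>j\<in>J. int (m j) * u j) + q * t"
    and b: "(\<Sum>j\<in>J. int (m j) * v j) = b + p * t"
  shows False
proof -
  have "0 \<le> (\<Sum>j\<in>J. int (m j) * u j)" "0 \<le> (\<Sum>j\<in>J. int (m j) * v j)"
    using nonneg by (auto intro!: sum_nonneg)
  then have "q * t < q * 1" "p * (-1) < p * t" using a b assms(5,6) by auto
  then have "t < 1" "-1 < t"
    using mult_less_cancel_left_pos[OF \<open>0 < q\<close>, of t 1]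
      mult_less_cancel_left_pos[OF \<open>0 < p\<close>, of "-1" t] by blast+
  then have "t = 0" by linarith
  with a b have ab: "a = (\<Sum>j\<in>J. int (m j) * u j)" "b = (\<Sum>j\<in>J. int (m j) * v j)" by simp_all
  with \<open>odd a\<close> have "odd (\<Sum>j\<in>J. int (m j) * u j)" by simp
  then obtain j where j: "j \<in> J" "0 < m j" "odd (u j)" by (rule odd_sum_has_odd_term)
  then have "u j \<le> a" "v j \<le> b"
    using coeff_le_sum[of J u j m] coeff_le_sum[of J v j m] assms(1) nonneg ab by auto
  then show False using incomp[OF j(1,3)] by linarith
qed

section \<open>The matrix is principal\<close>

lemma sum_three_entries:
  fixes X Y Z :: int and k n :: nat
  assumes "2 \<le> k" "k < n"
  shows "(\<Sum>j = 0..<n. if j = 0 then X else if j = 1 then Y else if j = k then Z else 0) = X + Y + Z"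
proof -
  have "(\<Sum>j = 0..<n. if j = 0 then X else if j = 1 then Y else if j = k then Z else 0)
      = (\<Sum>j = 0..<n. (if j = 0 then X else 0) + (if j = 1 then Y else 0) + (if j = k then Z else 0))"
    using assms by (intro sum.cong) auto
  then show ?thesis using assms by (simp add: sum.distrib)
qed

text \<open>Lower bounds on the positive multiples of a generator that the others generate do two jobs: they
  are one half of each diagonal entry, and, being at least \<open>2\<close>, they make the generators minimal. The
  rows of the matrix are relations that attain them.\<close>

lemma principal_matrix_T_mat:
  fixes p q n :: nat and \<alpha> \<beta> :: "nat \<Rightarrow> int" and h :: "nat \<Rightarrow> nat"
  assumes "coprime p q" "odd p" "odd q" "3 \<le> p" "3 \<le> q" "3 \<le> n"
    and adm: "admissible p q n \<alpha> \<beta>"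
    and h: "\<And>i. i \<in> {1..n - 2} \<Longrightarrow> 2 * int (h i) = \<alpha> i * int p + \<beta> i * int q"
  shows "principal_matrix (p # q # map h [1..<n - 1]) (T_mat p q n \<alpha> \<beta>)"
proof -
  define a where "a = p # q # map h [1..<n - 1]"
  define u where "u j = (if j = 0 then 2 else if j = 1 then 0 else \<alpha> (j - 1))" for j :: nat
  define v where "v j = (if j = 0 then 0 else if j = 1 then 2 else \<beta> (j - 1))" for j :: nat
  have len: "length a = n" using \<open>3 \<le> n\<close> by (simp add: a_def)
  have a0: "a ! 0 = p" and a1: "a ! 1 = q" by (simp_all add: a_def)
  have a2: "a ! j = h (j - 1)" if "2 \<le> j" "j < n" for j
    using that by (auto simp: a_def nth_Cons split: nat.split)
  have odd: "odd (\<alpha> i)" "odd (\<beta> i)" and pos: "0 < \<alpha> i" "0 < \<beta> i" if "i \<in> {1..n - 2}" for i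
    using adm that by (auto simp: admissible_def)
  have \<alpha>_less: "\<alpha> j < \<alpha> i" and \<beta>_less: "\<beta> i < \<beta> j"
    if "i \<in> {1..n - 2}" "j \<in> {1..n - 2}" "i < j" for i j
    using adm that unfolding admissible_def monotone_on_def by blast+
  have ends: "1 \<in> {1..n - 2}" "n - 2 \<in> {1..n - 2}" using \<open>3 \<le> n\<close> by auto
  have \<alpha>_le: "\<alpha> (n - 2) \<le> \<alpha> i" "\<alpha> i \<le> \<alpha> 1" and \<beta>_le: "\<beta> 1 \<le> \<beta> i" "\<beta> i \<le> \<beta> (n - 2)"
    if "i \<in> {1..n - 2}" for i
    using that ends \<alpha>_less[of i "n - 2"] \<alpha>_less[of 1 i] \<beta>_less[of 1 i] \<beta>_less[of i "n - 2"]
    by (cases "i = 1"; cases "i = n - 2"; force)+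
  have \<alpha>_q: "\<alpha> i < int q" and \<beta>_p: "\<beta> i < int p" if "i \<in> {1..n - 2}" for i
    using adm \<alpha>_le(2)[OF that] \<beta>_le(2)[OF that] by (auto simp: admissible_def)
  have idx: "j - 1 \<in> {1..n - 2}" if "2 \<le> j" "j < n" for j using that by auto
  have coord: "2 * int (a ! j) = u j * int p + v j * int q" if "j < n" for j
  proof -
    consider "j = 0" | "j = 1" | "2 \<le> j" by linarith
    then show ?thesis
      by cases (use a0 a1 a2[of j] h[of "j - 1"] idx[of j] that in \<open>auto simp: u_def v_def\<close>)
  qed
  have uv_nonneg: "0 \<le> u j" "0 \<le> v j" if "j < n" for j
    using pos[OF idx[of j]] that by (auto simp: u_def v_def)
  define G where "G i = monoid_gen {a ! j | j. j < length a \<and> j \<noteq> i}" for i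
  have G_eq: "G i = {(\<Sum>j\<in>{..<n} - {i}. m j * a ! j) | m. True}" for i
  proof -
    have "{a ! j | j. j < length a \<and> j \<noteq> i} = (\<lambda>j. a ! j) ` ({..<n} - {i})" using len by auto
    then show ?thesis by (simp add: G_def monoid_gen_image_eq)
  qed
  have cop: "coprime (int p) (int q)" using \<open>coprime p q\<close> by simp
  have G_relation: "\<exists>m t. int c * u i = (\<Sum>j\<in>{..<n} - {i}. int (m j) * u j) + int q * t
      \<and> (\<Sum>j\<in>{..<n} - {i}. int (m j) * v j) = int c * v i + int p * t"
    if "i < n" "c * a ! i \<in> G i" for i c
  proof -
    from that(2) obtain m where rel: "c * a ! i = (\<Sum>j\<in>{..<n} - {i}. m j * a ! j)"
      unfolding G_eq by blast
    have coord_on: "2 * int (a ! j) = u j * int p + v j * int q"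
      if "j \<in> insert i ({..<n} - {i})" for j using that coord \<open>i < n\<close> by auto
    have "int q \<noteq> 0" using \<open>3 \<le> q\<close> by simp
    from cop this coord_on rel obtain t where
      "int c * u i = (\<Sum>j\<in>{..<n} - {i}. int (m j) * u j) + int q * t"
      "(\<Sum>j\<in>{..<n} - {i}. int (m j) * v j) = int c * v i + int p * t"
      by (rule relation_coordinates[where g = "\<lambda>j. a ! j" and u = u and v = v])
    then show ?thesis by (intro exI conjI)
  qed

  have bound_p: "int q + \<alpha> (n - 2) \<le> 2 * int c" if c: "0 < c" "c * p \<in> G 0" for c
  proof -
    have "0 < n" "c * a ! 0 \<in> G 0" using c(2) a0 \<open>3 \<le> n\<close> by simp_all
    from G_relation[OF this] obtain m t where
      "int c * u 0 = (\<Sum>j\<in>{..<n} - {0}. int (m j) * u j) + int q * t"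
      "(\<Sum>j\<in>{..<n} - {0}. int (m j) * v j) = int c * v 0 + int p * t" by blast
    then have "2 * int c = (\<Sum>j\<in>{..<n} - {0}. int (m j) * u j) + int q * t"
      "(\<Sum>j\<in>{..<n} - {0}. int (m j) * v j) = int p * t"
      by (simp_all add: u_def[of 0] v_def[of 0])
    then show ?thesis
    proof (rule principal_coeff_lower_bound[rotated -2])
      show "\<alpha> (n - 2) \<le> int q" using \<alpha>_q[OF ends(2)] by simp
      show "0 < v j" if "j \<in> {..<n} - {0}" for j
        using that pos[OF idx[of j]] by (auto simp: v_def)
      show "\<alpha> (n - 2) \<le> u j" if "j \<in> {..<n} - {0}" "odd (u j)" for j
        using that \<alpha>_le[OF idx[of j]] by (auto simp: u_def split: if_splits)
    qed (use assms c uv_nonneg in auto)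
  qed
  have bound_q: "int p + \<beta> 1 \<le> 2 * int c" if c: "0 < c" "c * q \<in> G 1" for c
  proof -
    have "1 < n" "c * a ! 1 \<in> G 1" using c(2) a1 \<open>3 \<le> n\<close> by simp_all
    from G_relation[OF this] obtain m t where
      "int c * u 1 = (\<Sum>j\<in>{..<n} - {1}. int (m j) * u j) + int q * t"
      "(\<Sum>j\<in>{..<n} - {1}. int (m j) * v j) = int c * v 1 + int p * t" by blast
    \<comment> \<open>Exchanging the roles of the two coordinates replaces \<open>t\<close> by \<open>- t\<close>.\<close>
    moreover have "u 1 = 0" "v 1 = 2" by (simp_all add: u_def v_def)
    ultimately have "2 * int c = (\<Sum>j\<in>{..<n} - {1}. int (m j) * v j) + int p * (- t)"
      "(\<Sum>j\<in>{..<n} - {1}. int (m j) * u j) = int q * (- t)"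
      by (simp_all add: algebra_simps)
    then show ?thesis
    proof (rule principal_coeff_lower_bound[rotated -2])
      show "\<beta> 1 \<le> int p" using \<beta>_p[OF ends(1)] by simp
      show "0 < u j" if "j \<in> {..<n} - {1}" for j
        using that pos[OF idx[of j]] by (auto simp: u_def)
      show "\<beta> 1 \<le> v j" if "j \<in> {..<n} - {1}" "odd (v j)" for j
        using that \<beta>_le[OF idx[of j]] by (auto simp: v_def split: if_splits)
    qed (use assms c uv_nonneg in auto)
  qed
  have h_notin: "a ! i \<notin> G i" if i: "2 \<le> i" "i < n" for i
  proof
    assume "a ! i \<in> G i"
    then have "1 * a ! i \<in> G i" by simp
    from G_relation[OF i(2) this] obtain m t where
      "int 1 * u i = (\<Sum>j\<in>{..<n} - {i}. int (m j) * u j) + int q * t"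
      "(\<Sum>j\<in>{..<n} - {i}. int (m j) * v j) = int 1 * v i + int p * t" by blast
    then have "\<alpha> (i - 1) = (\<Sum>j\<in>{..<n} - {i}. int (m j) * u j) + int q * t"
      "(\<Sum>j\<in>{..<n} - {i}. int (m j) * v j) = \<beta> (i - 1) + int p * t"
      using i by (simp_all add: u_def[of i] v_def[of i])
    then show False
    proof (rule no_half_point_relation[rotated -2])
      show "\<alpha> (i - 1) < u j \<or> \<beta> (i - 1) < v j" if "j \<in> {..<n} - {i}" "odd (u j)" for j
      proof -
        have "2 \<le> j" "j < n" using that by (auto simp: u_def split: if_splits)
        then show ?thesis
          \<comment> \<open>Later elements have larger \<open>\<beta>\<close>, earlier ones larger \<open>\<alpha>\<close>.\<close>
          using that \<alpha>_less[OF idx[of j] idx[of i]] \<beta>_less[OF idx[of i] idx[of j]] i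
          by (cases "j < i") (auto simp: u_def v_def)
      qed
    qed (use assms odd[OF idx[OF i]] \<alpha>_q[OF idx[OF i]] \<beta>_p[OF idx[OF i]] uv_nonneg in auto)
  qed
  have min: "minimally_generating a"
  proof (rule minimally_generatingI)
    fix i assume "i < length a"
    then consider "i = 0" | "i = 1" | "2 \<le> i" "i < n" using len by linarith
    then have "a ! i \<notin> G i"
    proof cases
      case 1
      then show ?thesis using bound_p[of 1] a0 pos(1)[OF ends(2)] \<open>3 \<le> q\<close> by auto
    next
      case 2
      then show ?thesis using bound_q[of 1] a1 pos(2)[OF ends(1)] \<open>3 \<le> p\<close> by auto
    qed (rule h_notin)
    then show "a ! i \<notin> monoid_gen {a ! j | j. j < length a \<and> j \<noteq> i}" by (simp add: G_def)
  qed

  have row0: "T_mat p q n \<alpha> \<beta> $$ (0, j) = (if j = 0 then - ((int q + \<alpha> (n - 2)) div 2)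
      else if j = 1 then (int p - \<beta> (n - 2)) div 2 else if j = n - 1 then 1 else 0)"
    if "j < n" for j using that by (simp add: T_mat_def)
  have row1: "T_mat p q n \<alpha> \<beta> $$ (1, j) = (if j = 0 then (int q - \<alpha> 1) div 2
      else if j = 1 then - ((int p + \<beta> 1) div 2) else if j = 2 then 1 else 0)"
    if "j < n" for j using that \<open>3 \<le> n\<close> by (simp add: T_mat_def)
  have row2: "T_mat p q n \<alpha> \<beta> $$ (i, j) = (if j = 0 then \<alpha> (i - 1)
      else if j = 1 then \<beta> (i - 1) else if j = i then - 2 else 0)"
    if "2 \<le> i" "i < n" "j < n" for i j using that by (simp add: T_mat_def)

  have nonneg: "0 \<le> T_mat p q n \<alpha> \<beta> $$ (i, j)" if "i < n" "j < n" "i \<noteq> j" for i j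
  proof -
    consider "i = 0" | "i = 1" | "2 \<le> i" by linarith
    then show ?thesis
    proof cases
      case 1 then show ?thesis using that row0[of j] \<beta>_p[OF ends(2)] by auto
    next
      case 2 then show ?thesis using that row1[of j] \<alpha>_q[OF ends(1)] by auto
    next
      case 3 then show ?thesis using that row2[of i j] pos[OF idx[of i]] by auto
    qed
  qed

  have row_sum_three: "(\<Sum>j = 0..<n. T_mat p q n \<alpha> \<beta> $$ (i, j) * int (a ! j))
      = X * int p + Y * int q + Z * int (h (k - 1))"
    if "\<And>j. j < n \<Longrightarrow> T_mat p q n \<alpha> \<beta> $$ (i, j)
        = (if j = 0 then X else if j = 1 then Y else if j = k then Z else 0)" "2 \<le> k" "k < n"
    for i k X Y Z
  proof -
    have "(\<Sum>j = 0..<n. T_mat p q n \<alpha> \<beta> $$ (i, j) * int (a ! j)) = (\<Sum>j = 0..<n.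
        if j = 0 then X * int p else if j = 1 then Y * int q
        else if j = k then Z * int (h (k - 1)) else 0)"
      using that a0 a1 a2 by (intro sum.cong) auto
    then show ?thesis using sum_three_entries[OF that(2,3)] by simp
  qed
  have row_sum: "(\<Sum>j = 0..<n. T_mat p q n \<alpha> \<beta> $$ (i, j) * int (a ! j)) = 0" if "i < n" for i
  proof -
    consider "i = 0" | "i = 1" | "2 \<le> i" by linarith
    then show ?thesis
    proof cases
      case 1
      have "2 * ((int q + \<alpha> (n - 2)) div 2) = int q + \<alpha> (n - 2)"
        "2 * ((int p - \<beta> (n - 2)) div 2) = int p - \<beta> (n - 2)"
        using odd[OF ends(2)] \<open>odd p\<close> \<open>odd q\<close> by simp_all
      moreover have "2 * int (h (n - 1 - 1)) = \<alpha> (n - 2) * int p + \<beta> (n - 2) * int q"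
        using h[OF ends(2)] by (simp add: numeral_2_eq_2)
      moreover have "2 * (- X * int p + Y * int q + 1 * H) = - (2 * X) * int p + 2 * Y * int q + 2 * H"
        for X Y H by simp
      ultimately have "2 * (- ((int q + \<alpha> (n - 2)) div 2) * int p + (int p - \<beta> (n - 2)) div 2 * int q
          + 1 * int (h (n - 1 - 1))) = 0"
        by (simp only:) (simp add: algebra_simps)
      then have "- ((int q + \<alpha> (n - 2)) div 2) * int p + (int p - \<beta> (n - 2)) div 2 * int q
          + 1 * int (h (n - 1 - 1)) = 0" by (simp only: mult_eq_0_iff) simp
      then show ?thesis unfolding 1 using \<open>3 \<le> n\<close> by (subst row_sum_three[OF row0]) auto
    next
      case 2
      have "2 * ((int q - \<alpha> 1) div 2) = int q - \<alpha> 1"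
        "2 * ((int p + \<beta> 1) div 2) = int p + \<beta> 1"
        using odd[OF ends(1)] \<open>odd p\<close> \<open>odd q\<close> by simp_all
      moreover have "2 * int (h (2 - 1)) = \<alpha> 1 * int p + \<beta> 1 * int q"
        using h[OF ends(1)] by simp
      moreover have "2 * (X * int p + - Y * int q + 1 * H) = 2 * X * int p - (2 * Y) * int q + 2 * H"
        for X Y H by simp
      ultimately have "2 * ((int q - \<alpha> 1) div 2 * int p + - ((int p + \<beta> 1) div 2) * int q
          + 1 * int (h (2 - 1))) = 0"
        by (simp only:) (simp add: algebra_simps)
      then have "(int q - \<alpha> 1) div 2 * int p + - ((int p + \<beta> 1) div 2) * int q
          + 1 * int (h (2 - 1)) = 0" by (simp only: mult_eq_0_iff) simp
      then show ?thesis unfolding 2 using \<open>3 \<le> n\<close> by (subst row_sum_three[OF row1]) auto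
    next
      case 3
      then show ?thesis using row_sum_three[OF row2[OF 3 that]] h[OF idx[OF 3 that]] that by simp
    qed
  qed

  \<comment> \<open>Moving the diagonal term of row \<open>i\<close> to the other side writes \<open>c * a ! i\<close> in the other generators.\<close>
  have attained: "c * a ! i \<in> G i" if "i < n" "T_mat p q n \<alpha> \<beta> $$ (i, i) = - int c" for i c
  proof -
    have "0 = (\<Sum>j\<in>{..<n}. T_mat p q n \<alpha> \<beta> $$ (i, j) * int (a ! j))"
      using row_sum[OF that(1)] by (simp add: lessThan_atLeast0)
    also have "\<dots> = - int c * int (a ! i)
        + (\<Sum>j\<in>{..<n} - {i}. T_mat p q n \<alpha> \<beta> $$ (i, j) * int (a ! j))"
      using that by (subst sum.remove[of _ i]) auto
    also have "(\<Sum>j\<in>{..<n} - {i}. T_mat p q n \<alpha> \<beta> $$ (i, j) * int (a ! j))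
        = int (\<Sum>j\<in>{..<n} - {i}. nat (T_mat p q n \<alpha> \<beta> $$ (i, j)) * a ! j)"
      unfolding of_nat_sum using nonneg[OF that(1)] by (intro sum.cong) auto
    finally have "int (c * a ! i) = int (\<Sum>j\<in>{..<n} - {i}. nat (T_mat p q n \<alpha> \<beta> $$ (i, j)) * a ! j)"
      by simp
    then show ?thesis unfolding G_eq of_nat_eq_iff
      by (intro CollectI exI[of _ "\<lambda>j. nat (T_mat p q n \<alpha> \<beta> $$ (i, j))"] conjI TrueI)
  qed

  have diag: "\<exists>c. principal_coeff a i c \<and> T_mat p q n \<alpha> \<beta> $$ (i, i) = - int c" if i: "i < n" for i
  proof -
    have "\<exists>c>0. T_mat p q n \<alpha> \<beta> $$ (i, i) = - int c \<and> (\<forall>d. 0 < d \<and> d * a ! i \<in> G i \<longrightarrow> c \<le> d)"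
    proof -
      consider "i = 0" | "i = 1" | "2 \<le> i" by linarith
      then show ?thesis
      proof cases
        case 1
        have "nat ((int q + \<alpha> (n - 2)) div 2) \<le> d" if "0 < d" "d * a ! i \<in> G i" for d
          using bound_p[of d] that 1 a0 by simp
        moreover have "0 < (int q + \<alpha> (n - 2)) div 2"
          using pos(1)[OF ends(2)] \<open>3 \<le> q\<close> by simp
        ultimately show ?thesis
          using 1 row0[OF i] by (intro exI[of _ "nat ((int q + \<alpha> (n - 2)) div 2)"] conjI) auto
      next
        case 2
        have "nat ((int p + \<beta> 1) div 2) \<le> d" if "0 < d" "d * a ! i \<in> G i" for d
          using bound_q[of d] that 2 a1 by simp
        moreover have "0 < (int p + \<beta> 1) div 2"
          using pos(2)[OF ends(1)] \<open>3 \<le> p\<close> by simp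
        ultimately show ?thesis
          using 2 row1[of 1] i by (intro exI[of _ "nat ((int p + \<beta> 1) div 2)"] conjI) auto
      next
        case 3
        have "2 \<le> d" if "0 < d" "d * a ! i \<in> G i" for d
          using that h_notin[OF 3 i] by (cases "d = 1") auto
        then show ?thesis using row2[OF 3 i i] 3 by (intro exI[of _ 2]) auto
      qed
    qed
    then show ?thesis
      using attained[OF i] unfolding principal_coeff_def Let_def G_def[symmetric] by blast
  qed

  have "0 < a ! j" if "j < n" for j
  proof -
    consider "j = 0" | "j = 1" | "2 \<le> j" by linarith
    then show ?thesis
    proof cases
      case 3
      have "0 < \<alpha> (j - 1) * int p + \<beta> (j - 1) * int q"
        using pos[OF idx[OF 3 that]] \<open>3 \<le> p\<close> \<open>3 \<le> q\<close> by (intro add_pos_pos mult_pos_pos) auto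
      then show ?thesis using h[OF idx[OF 3 that]] a2[OF 3 that] by simp
    qed (use a0 a1 \<open>3 \<le> p\<close> \<open>3 \<le> q\<close> in auto)
  qed
  then have "\<forall>x\<in>set a. 0 < x" using len by (auto simp: in_set_conv_nth)
  moreover have carrier: "T_mat p q n \<alpha> \<beta> \<in> carrier_mat n n" by (simp add: T_mat_def)
  moreover have "T_mat p q n \<alpha> \<beta> *\<^sub>v vec_of_list (map int a) = 0\<^sub>v n"
  proof (rule eq_vecI)
    fix i assume "i < dim_vec (0\<^sub>v n :: int vec)"
    then show "(T_mat p q n \<alpha> \<beta> *\<^sub>v vec_of_list (map int a)) $ i = 0\<^sub>v n $ i"
      using row_sum[of i] carrier len by (simp add: scalar_prod_def vec_of_list_index)
  qed (use carrier in auto)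
  ultimately have "principal_matrix a (T_mat p q n \<alpha> \<beta>)"
    unfolding principal_matrix_def len using min diag nonneg by blast
  then show ?thesis by (simp add: a_def)
qed

section \<open>Membership in the class \<open>KW\<close>\<close>

text \<open>For odd \<open>\<alpha> i = 2 * k + 1\<close> and \<open>\<beta> i = 2 * l + 1\<close> the equation for \<open>h i\<close> says that
  \<open>h i = k * p + l * q + (p + q) / 2\<close>.\<close>

lemma monoid_gen_in_KW:
  fixes p q n :: nat and \<alpha> \<beta> :: "nat \<Rightarrow> int" and h :: "nat \<Rightarrow> nat"
  assumes "coprime p q" "odd p" "odd q"
    and \<alpha>\<beta>: "\<And>i. i \<in> {1..n - 2} \<Longrightarrow> odd (\<alpha> i) \<and> 0 < \<alpha> i \<and> odd (\<beta> i) \<and> 0 < \<beta> i"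
    and h: "\<And>i. i \<in> {1..n - 2} \<Longrightarrow> 2 * int (h i) = \<alpha> i * int p + \<beta> i * int q"
  shows "monoid_gen (set (p # q # map h [1..<n - 1])) \<in> KW p q"
proof -
  let ?S = "set (p # q # map h [1..<n - 1])" and ?r = "(p + q) div 2"
  have "Gcd ?S dvd p" "Gcd ?S dvd q" by (intro Gcd_dvd; simp)+
  then have "Gcd ?S = 1" using \<open>coprime p q\<close> by (metis coprime_common_divisor_nat)
  then have "numerical_semigroup (monoid_gen ?S)" unfolding numerical_semigroup_def by blast
  moreover have "monoid_gen {p, q} \<subseteq> monoid_gen ?S"
    using subset_monoid_gen[of ?S] by (subst monoid_gen_subset_iff) auto
  moreover have "monoid_gen ?S \<subseteq> monoid_gen {p, q, ?r}"
  proof -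
    note sub = subset_monoid_gen[of "{p, q, ?r}"]
    have "h i \<in> monoid_gen {p, q, ?r}" if i: "i \<in> {1..n - 2}" for i
    proof -
      from \<alpha>\<beta>[OF i] obtain k l where kl: "\<alpha> i = 2 * k + 1" "\<beta> i = 2 * l + 1" by (elim conjE oddE)
      with \<alpha>\<beta>[OF i] have "0 \<le> k" "0 \<le> l" by auto
      have r: "2 * int ?r = int p + int q" using \<open>odd p\<close> \<open>odd q\<close> by (simp add: of_nat_div)
      have "2 * int (h i) = 2 * (k * int p + l * int q + int ?r)"
        using h[OF i] kl r by (simp add: algebra_simps)
      also have "\<dots> = 2 * int (nat k * p + nat l * q + ?r)"
        using \<open>0 \<le> k\<close> \<open>0 \<le> l\<close> by simp
      finally have "int (h i) = int (nat k * p + nat l * q + ?r)"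
        by (simp only: mult_cancel_left) simp
      then have "h i = nat k * p + nat l * q + ?r" by (simp only: of_nat_eq_iff)
      then show ?thesis using sub
        by (auto intro!: submonoid_nat_add submonoid_nat_mult submonoid_nat_monoid_gen)
    qed
    then show ?thesis using sub by (subst monoid_gen_subset_iff) auto
  qed
  ultimately show ?thesis using \<open>odd p\<close> \<open>odd q\<close> by (simp add: KW_def)
qed

section \<open>Principal matrices of the semigroups in \<open>KW\<close>\<close>

theorem corollary1p2:
  fixes p q n :: nat
  assumes "prime p" and "prime q" and "3 \<le> p" and "p < q" and "3 \<le> n"
  shows
    "(\<forall>(x :: nat \<Rightarrow> int) (y :: nat \<Rightarrow> int) (h :: nat \<Rightarrow> nat) (A :: nat set).
        A = monoid_gen (set (p # q # map h [1..<n - 1])) \<and>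
        A \<in> KW p q \<and>
        embedding_dimension A = n \<and>
        minimally_generating (p # q # map h [1..<n - 1]) \<and>
        (\<forall>i\<in>{1..n - 2}. int (h i) = int p * int q - x i * int p - y i * int q) \<and>
        0 < x 1 \<and> strict_mono_on {1..n - 2} x \<and>
        strict_antimono_on {1..n - 2} y \<and> y (n - 2) > 0 \<and>
        (\<forall>i\<in>{1..n - 2}. 2 * x i \<le> int q \<and> 2 * y i \<le> int p)
        \<longrightarrow> (\<exists>\<alpha> \<beta>. admissible p q n \<alpha> \<beta> \<and>
               principal_matrix (p # q # map h [1..<n - 1]) (T_mat p q n \<alpha> \<beta>)))
     \<and>
     (\<forall>\<alpha> \<beta>. admissible p q n \<alpha> \<beta> \<longrightarrow>
        (\<exists>H\<in>KW p q. \<exists>a. H = monoid_gen (set a) \<and> principal_matrix a (T_mat p q n \<alpha> \<beta>)))"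
proof (intro conjI allI impI; (elim conjE)?)
  have "odd p" "odd q" "3 \<le> q"
    using assms prime_odd_nat[of p] prime_odd_nat[of q] by auto
  have "coprime p q" using assms by (simp add: primes_coprime)
  note hyps = \<open>coprime p q\<close> \<open>odd p\<close> \<open>odd q\<close> \<open>3 \<le> p\<close> \<open>3 \<le> q\<close> \<open>3 \<le> n\<close>
  {
    fix x y :: "nat \<Rightarrow> int" and h :: "nat \<Rightarrow> nat" and A :: "nat set"
    assume h: "\<forall>i\<in>{1..n - 2}. int (h i) = int p * int q - x i * int p - y i * int q"
      and x: "0 < x 1" "strict_mono_on {1..n - 2} x"
      and y: "strict_antimono_on {1..n - 2} y" "y (n - 2) > 0"
      and half: "\<forall>i\<in>{1..n - 2}. 2 * x i \<le> int q \<and> 2 * y i \<le> int p"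
    define \<alpha> where "\<alpha> i = int q - 2 * x i" for i
    define \<beta> where "\<beta> i = int p - 2 * y i" for i
    have odd: "odd (\<alpha> i)" "odd (\<beta> i)" for i
      using \<open>odd p\<close> \<open>odd q\<close> by (simp_all add: \<alpha>_def \<beta>_def)
    \<comment> \<open>The bounds on \<open>x\<close> and \<open>y\<close> give nonnegativity, and odd numbers are nonzero.\<close>
    have pos: "0 < \<alpha> i" "0 < \<beta> i" if "i \<in> {1..n - 2}" for i
    proof -
      have "0 \<le> \<alpha> i" "0 \<le> \<beta> i" using half that by (auto simp: \<alpha>_def \<beta>_def)
      moreover have "\<alpha> i \<noteq> 0" "\<beta> i \<noteq> 0" using odd[of i] by (metis dvd_0_right)+
      ultimately show "0 < \<alpha> i" "0 < \<beta> i" by simp_all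
    qed
    have adm: "admissible p q n \<alpha> \<beta>"
      unfolding admissible_def
    proof (intro conjI)
      show "\<forall>i\<in>{1..n - 2}. odd (\<alpha> i) \<and> 0 < \<alpha> i \<and> odd (\<beta> i) \<and> 0 < \<beta> i"
        using odd pos by blast
      show "strict_antimono_on {1..n - 2} \<alpha>" "strict_mono_on {1..n - 2} \<beta>"
        using x(2) y(1) by (simp_all add: monotone_on_def \<alpha>_def \<beta>_def)
    qed (use x(1) y(2) pos[of 1] pos[of "n - 2"] \<open>3 \<le> n\<close> in \<open>auto simp: \<alpha>_def \<beta>_def\<close>)
    have "2 * int (h i) = \<alpha> i * int p + \<beta> i * int q" if "i \<in> {1..n - 2}" for i
      using bspec[OF h that] by (simp add: \<alpha>_def \<beta>_def algebra_simps)
    from principal_matrix_T_mat[OF hyps adm this] adm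
    show "\<exists>\<alpha> \<beta>. admissible p q n \<alpha> \<beta> \<and>
        principal_matrix (p # q # map h [1..<n - 1]) (T_mat p q n \<alpha> \<beta>)" by blast
  }
  fix \<alpha> \<beta> assume adm: "admissible p q n \<alpha> \<beta>"
  define h where "h i = nat ((\<alpha> i * int p + \<beta> i * int q) div 2)" for i
  have \<alpha>\<beta>: "odd (\<alpha> i) \<and> 0 < \<alpha> i \<and> odd (\<beta> i) \<and> 0 < \<beta> i" if "i \<in> {1..n - 2}" for i
    using adm that by (simp add: admissible_def)
  have h: "2 * int (h i) = \<alpha> i * int p + \<beta> i * int q" if "i \<in> {1..n - 2}" for i
    using \<alpha>\<beta>[OF that] \<open>odd p\<close> \<open>odd q\<close> by (simp add: h_def)
  show "\<exists>H\<in>KW p q. \<exists>a. H = monoid_gen (set a) \<and> principal_matrix a (T_mat p q n \<alpha> \<beta>)"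
  proof (intro bexI exI conjI)
    show "principal_matrix (p # q # map h [1..<n - 1]) (T_mat p q n \<alpha> \<beta>)"
      using hyps adm h by (rule principal_matrix_T_mat)
    show "monoid_gen (set (p # q # map h [1..<n - 1])) \<in> KW p q"
      using hyps(1-3) \<alpha>\<beta> h by (rule monoid_gen_in_KW)
  qed (rule refl)
qed

end
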